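(* Let $F \subseteq \mathbb{N}$ be a finite set such that either $F = \emptyset$ or $\min F \geq 3$, and assume moreover that $2 \notin F$, $5 \notin F$ and $10 \notin F$. Then for every odd integer $n \geq 5$ we have $Q_{U(F,n)} \geq \frac{5}{3}$. In particular, $Q_{U(\emptyset,n)} \geq \frac{5}{3}$ for every odd $n \geq 5$.
   Context: For a nonzero integer $N$, $\mathrm{rad}(N)$ denotes the largest square-free positive divisor of $N$. For $a = (a_1,\ldots,a_n) \in \mathbb{Z}^n$ with all $a_i \neq 0$, the quality of $a$ is $q(a) = \frac{\log(\max\{|a_1|,\ldots,|a_n|\})}{\log \mathrm{rad}(a_1 \cdots a_n)}$. For a set $A$ of such $n$-tuples, $Q_A$ denotes the limit superior of $q(a)$ over $a \in A$ (i.e. the limsup of $q(a^{(k)})$ along an enumeration $a^{(1)}, a^{(2)}, \ldots$ of $A$; equivalently $\inf_{S \subseteq A \text{ finite}} \sup_{a \in A \setminus S} q(a)$). For $n \geq 3$ and a finite set $F \subseteq \mathbb{N}$ (with $\min F \geq 3$ if $F \neq \emptyset$), $U(F,n)$ is the set of all $(a_1,\ldots,a_n) \in \mathbb{Z}^n$ such that: (i) $\gcd(a_i,a_j) = 1$ for all $1 \leq i < j \leq n$; (ii) $a_1 + \cdots + a_n = 0$; (iii) there are no $b_1,\ldots,b_n \in \{-1,0,1\}$ and indices $i,j \in \{1,\ldots,n\}$ with $b_i = 0$, $b_j = 1$ and $\sum_{k=1}^n b_k a_k = 0$; (iv) none of $a_1,\ldots,a_n$ is a multiple of any element of $F$. (Condition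 (iii) forces all $a_i \neq 0$.) *)

theory Defs
  imports
    "HOL-Analysis.Analysis"
    "HOL-Computational_Algebra.Squarefree"
begin

(* Only meaningful for N \<noteq> 0: otherwise the set of divisors is unbounded. *)
definition rad :: "int \<Rightarrow> int" where
  "rad N = Max {d. 0 < d \<and> squarefree d \<and> d dvd N}"

(* n-tuples of integers are lists of length n; the entry a_i is a ! (i - 1). *)

(* If all entries are 1 or -1, then both logarithms vanish and the value is 0 / 0 = 0.
   For fixed n only finitely many tuples are affected. *)
definition quality :: "int list \<Rightarrow> real" where
  "quality a = ln (real_of_int (Max ((\<lambda>x. \<bar>x\<bar>) ` set a))) / ln (real_of_int (rad (prod_list a)))"

(* The limit superior is taken in the extended reals; it is -\<infinity> for finite A. *)
definition Q :: "int list set \<Rightarrow> ereal" where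
  "Q A = (INF S\<in>{S. finite S \<and> S \<subseteq> A}. SUP a\<in>A - S. ereal (quality a))"

definition U :: "nat set \<Rightarrow> nat \<Rightarrow> int list set" where
  "U F n = {a. length a = n \<and>
     (\<forall>i<n. \<forall>j<n. i < j \<longrightarrow> gcd (a ! i) (a ! j) = 1) \<and>
     (\<Sum>i<n. a ! i) = 0 \<and>
     \<not> (\<exists>b :: nat \<Rightarrow> int. (\<forall>k<n. b k \<in> {-1, 0, 1}) \<and>
          (\<exists>i<n. \<exists>j<n. b i = 0 \<and> b j = 1) \<and> (\<Sum>k<n. b k * a ! k) = 0) \<and>
     (\<forall>i<n. \<forall>m\<in>F. \<not> int m dvd a ! i)}"

lemma rad_greatest:
  assumes "N \<noteq> 0"
  shows "0 < rad N" "squarefree (rad N)" "rad N dvd N"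
    and "0 < d \<Longrightarrow> squarefree d \<Longrightarrow> d dvd N \<Longrightarrow> d \<le> rad N"
proof -
  let ?D = "{d. 0 < d \<and> squarefree d \<and> d dvd N}"
  have fin: "finite ?D"
    using finite_divisors_int[OF assms] by (rule finite_subset[rotated]) auto
  have "1 \<in> ?D" by simp
  then have "Max ?D \<in> ?D" using fin by (intro Max_in) blast+
  then show "0 < rad N" "squarefree (rad N)" "rad N dvd N"
    by (auto simp: rad_def)
  show "d \<le> rad N" if "0 < d" "squarefree d" "d dvd N"
    unfolding rad_def using fin that by (intro Max_ge) auto
qed

lemma Q_eq_Limsup: "Q A = Limsup (inf cofinite (principal A)) (\<lambda>a. ereal (quality a))"
proof -
  have ev: "eventually P (inf cofinite (principal A)) \<longleftrightarrow> finite {a \<in> A. \<not> P a}" for P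
    by (simp add: eventually_inf_principal eventually_cofinite)
  show ?thesis
    unfolding Q_def Limsup_def
  proof (rule INF_eq)
    fix S assume "S \<in> {S. finite S \<and> S \<subseteq> A}"
    then have S: "finite S" by simp
    have "{a \<in> A. \<not> a \<in> A - S} \<subseteq> S" by auto
    then have "eventually (\<lambda>a. a \<in> A - S) (inf cofinite (principal A))"
      using S by (simp only: ev finite_subset)
    then show "\<exists>P\<in>{P. eventually P (inf cofinite (principal A))}.
        (SUP a\<in>{a. P a}. ereal (quality a)) \<le> (SUP a\<in>A - S. ereal (quality a))"
      by (intro bexI[of _ "\<lambda>a. a \<in> A - S"]) (simp_all only: Collect_mem_eq mem_Collect_eq order.refl)
  next
    fix P assume "P \<in> {P. eventually P (inf cofinite (principal A))}"
    then have "finite {a \<in> A. \<not> P a}" by (simp add: ev)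
    then show "\<exists>S\<in>{S. finite S \<and> S \<subseteq> A}.
        (SUP a\<in>A - S. ereal (quality a)) \<le> (SUP a\<in>{a. P a}. ereal (quality a))"
      by (intro bexI[of _ "{a \<in> A. \<not> P a}"] SUP_subset_mono) auto
  qed
qed

lemma Q_eq_limsup_enumeration:
  assumes "bij_betw e (UNIV :: nat set) A"
  shows "Q A = limsup (\<lambda>k. ereal (quality (e k)))"
proof -
  have inj: "inj e" and ran: "range e = A"
    using assms by (auto simp: bij_betw_def)
  show ?thesis
    unfolding Q_def limsup_INF_SUP
  proof (rule INF_eq)
    fix S assume "S \<in> {S. finite S \<and> S \<subseteq> A}"
    then have "finite (e -` S)" using inj by (simp add: finite_vimageI)
    then obtain n where n: "\<And>k. k \<in> e -` S \<Longrightarrow> k < n"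
      unfolding finite_nat_set_iff_bounded by auto
    have "e ` {n..} \<subseteq> A - S"
    proof
      fix a assume "a \<in> e ` {n..}"
      then obtain k where k: "a = e k" "n \<le> k" by auto
      then have "e k \<notin> S" using n[of k] by auto
      with k(1) ran show "a \<in> A - S" by blast
    qed
    then show "\<exists>n\<in>UNIV. (SUP k\<in>{n..}. ereal (quality (e k))) \<le> (SUP a\<in>A - S. ereal (quality a))"
      by (intro bexI[of _ n] SUP_mono) auto
  next
    fix n :: nat
    show "\<exists>S\<in>{S. finite S \<and> S \<subseteq> A}.
        (SUP a\<in>A - S. ereal (quality a)) \<le> (SUP k\<in>{n..}. ereal (quality (e k)))"
    proof (intro bexI[of _ "e ` {..<n}"] SUP_mono)
      fix a assume a: "a \<in> A - e ` {..<n}"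
      then obtain k where "a = e k" using ran by auto
      with a show "\<exists>k\<in>{n..}. ereal (quality a) \<le> ereal (quality (e k))"
        by (intro bexI[of _ k]) auto
    qed (use ran in auto)
  qed
qed

end

theory Submission
  imports Defs "HOL-Real_Asymp.Real_Asymp"
begin

text \<open>
  The proof rests on the identity
  \<open>(x + 1)^5 - (x - 1)^5 - 10 (x\<^sup>2 + 1)\<^sup>2 + 8 = 0\<close>. The constant \<open>8\<close> is split into an even
  number of pairwise coprime constants without small prime factors and without further vanishing
  signed subsums; this is possible since all but two of them can be chosen growing rapidly, and the
  last two have the form \<open>h + t\<close>, \<open>h - t\<close> with prescribed \<open>h\<close> and large \<open>t\<close>. For \<open>x\<close> a multiple of \<open>10\<close>,
  of these constants and of the elements of \<open>F\<close>, the coprimality and divisibility conditions hold.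
  Taking \<open>x + 1 = y^k\<close> with \<open>y\<close> fixed, the radical is at most a constant times
  \<open>(x - 1) (x\<^sup>2 + 1) < y^(3 k)\<close>, whereas the maximum is at least \<open>y^(5 k)\<close>.
\<close>

section \<open>Signed sums over lists and elementary divisibility\<close>

lemma sum_lessThan_nth_Cons:
  fixes b :: "nat \<Rightarrow> int"
  shows "(\<Sum>i<length (x # xs). b i * (x # xs) ! i) =
    b 0 * x + (\<Sum>i<length xs. b (Suc i) * xs ! i)"
  by (simp only: length_Cons sum.lessThan_Suc_shift nth_Cons_0 nth_Cons_Suc)

lemma all_less_length_Cons:
  "(\<forall>i<length (x # xs). R i) \<longleftrightarrow> R 0 \<and> (\<forall>i<length xs. R (Suc i))"
  by (simp add: All_less_Suc2)

lemma abs_sum_mult_nth_le: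
  fixes b :: "nat \<Rightarrow> int"
  assumes "\<And>i. i < length xs \<Longrightarrow> \<bar>b i\<bar> \<le> B"
  shows "\<bar>\<Sum>i<length xs. b i * xs ! i\<bar> \<le> B * sum_list (map abs xs)"
  using assms
proof (induction xs arbitrary: b)
  case (Cons x xs)
  have "\<bar>b 0 * x\<bar> \<le> B * \<bar>x\<bar>"
    using Cons.prems[of 0] by (simp add: abs_mult mult_right_mono)
  moreover have "\<bar>\<Sum>i<length xs. b (Suc i) * xs ! i\<bar> \<le> B * sum_list (map abs xs)"
    using Cons.prems by (intro Cons.IH) auto
  ultimately show ?case
    unfolding sum_lessThan_nth_Cons by (simp add: algebra_simps)
qed simp

text \<open>A nonzero multiple of \<open>t\<close> is at least \<open>t\<close> in size. This is how
  the coefficient of a dominating term in a signed sum is shown to vanish.\<close>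

lemma zero_if_abs_mult_less:
  fixes a b t :: int
  assumes "a * t = b" "\<bar>b\<bar> < t"
  shows "a = 0"
proof (rule ccontr)
  assume "a \<noteq> 0"
  then have "1 * \<bar>t\<bar> \<le> \<bar>a\<bar> * \<bar>t\<bar>" by (intro mult_right_mono) auto
  with assms show False by (simp add: abs_mult[symmetric])
qed

lemma coprime_if_dvd_diff_unit:
  fixes u v z :: int
  assumes "is_unit v" "z dvd u - v"
  shows "coprime u z"
proof (rule coprimeI)
  fix c assume "c dvd u" "c dvd z"
  then have "c dvd u - (u - v)" using assms(2) by (meson dvd_diff dvd_trans)
  then have "c dvd v" by simp
  then show "is_unit c" using assms(1) by (rule dvd_trans)
qed

text \<open>Each prime has multiplicity at most 1 in \<open>d\<close>, and a prime that does occur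
  in \<open>d\<close> divides \<open>z ^ n\<close>, hence \<open>z\<close>.\<close>

lemma squarefree_dvd_power_imp_dvd:
  fixes d z :: "'a :: factorial_semiring_multiplicative"
  assumes "squarefree d" "d dvd z ^ n"
  shows "d dvd z"
proof (cases "z = 0")
  case False
  have d: "d \<noteq> 0" using assms(1) by auto
  show ?thesis
  proof (rule multiplicity_le_imp_dvd)
    fix p :: 'a assume p: "prime p"
    have "multiplicity p d \<le> 1" using assms(1) d p squarefree_factorial_semiring'' by blast
    moreover have "multiplicity p d = 0" if "multiplicity p z = 0"
      using dvd_imp_multiplicity_le[OF assms(2), of p] that False p
      by (simp add: prime_elem_multiplicity_power_distrib)
    ultimately show "multiplicity p d \<le> multiplicity p z" by linarith
  qed (fact d)
qed simp

section \<open>Splitting 8 into pairwise coprime constants\<close>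

text \<open>The bound 2 covers differences of two coefficients from {-1, 0, 1}, which arise when a
  multiple of a full relation is subtracted. The coefficient \<open>g\<close> treats
  \<open>s\<close> as one more entry.\<close>

definition two_independent :: "int \<Rightarrow> int list \<Rightarrow> bool" where
  "two_independent s e \<longleftrightarrow> (\<forall>g b. \<bar>g\<bar> \<le> 2 \<longrightarrow> (\<forall>i<length e. \<bar>b i\<bar> \<le> 2) \<longrightarrow>
      s * g + (\<Sum>i<length e. b i * e ! i) = 0 \<longrightarrow> g = 0 \<and> (\<forall>i<length e. b i = 0))"

lemma two_independentD:
  assumes "two_independent s e" "\<bar>g\<bar> \<le> 2" "\<forall>i<length e. \<bar>b i\<bar> \<le> 2"
    "s * g + (\<Sum>i<length e. b i * e ! i) = 0"
  shows "g = 0 \<and> (\<forall>i<length e. b i = 0)"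
  using assms unfolding two_independent_def by blast

text \<open>For \<open>s = 8\<close>, \<open>g\<close> is the common coefficient of the three
  quintic terms, whose sum is -8. The case \<open>g = 0\<close> rules out nontrivial vanishing
  signed subsums of \<open>cs\<close>.\<close>

definition only_full_subsum :: "int \<Rightarrow> int list \<Rightarrow> bool" where
  "only_full_subsum s cs \<longleftrightarrow> (\<forall>g b. g \<in> {-1, 0, 1} \<longrightarrow> (\<forall>i<length cs. b i \<in> {-1, 0, 1}) \<longrightarrow>
      (\<Sum>i<length cs. b i * cs ! i) = s * g \<longrightarrow> (\<forall>i<length cs. b i = g))"

lemma only_full_subsumD:
  assumes "only_full_subsum s cs" "g \<in> {-1, 0, 1}" "\<forall>i<length cs. b i \<in> {-1, 0, 1}"
    "(\<Sum>i<length cs. b i * cs ! i) = s * g"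
  shows "\<forall>i<length cs. b i = g"
  using assms unfolding only_full_subsum_def by blast

text \<open>Induction: the new entry is 1 modulo \<open>P\<close> and modulo all earlier entries,
  and it exceeds every combination of 8 and these entries with coefficients of size at most 2. Its
  own coefficient in a relation is therefore 0.\<close>

lemma exists_independent_coprime_list:
  fixes P :: int
  assumes "P > 0" "even P"
  shows "\<exists>e. length e = m \<and> sorted_wrt coprime e \<and> (\<forall>c\<in>set e. coprime c P) \<and> two_independent 8 e"
proof (induction m)
  case 0
  show ?case by (intro exI[of _ "[]"]) (simp add: two_independent_def)
next
  case (Suc m)
  then obtain e where e: "length e = m" "sorted_wrt coprime e" "\<forall>c\<in>set e. coprime c P"
    and ind: "two_independent 8 e"
    by blast
  define R where "R = \<bar>P * prod_list e\<bar> * (16 + 2 * sum_list (map abs e))"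
  have nz: "0 \<notin> set e" using e(3) assms by auto
  define d where "d = 1 + R"
  have nonneg: "sum_list (map abs e) \<ge> 0" by (intro sum_list_nonneg) auto
  have "P * prod_list e \<noteq> 0" using assms nz by (simp add: prod_list_zero_iff)
  then have "\<bar>P * prod_list e\<bar> \<ge> 1" by linarith
  then have "1 * (16 + 2 * sum_list (map abs e)) \<le> R"
    unfolding R_def using nonneg by (intro mult_right_mono) auto
  then have big: "d > 16 + 2 * sum_list (map abs e)" by (simp add: d_def)
  have cop: "coprime d z" if "z dvd P * prod_list e" for z
    using that by (intro coprime_if_dvd_diff_unit[of 1]) (simp_all add: d_def R_def)
  have zero: "g = 0 \<and> (\<forall>i<length (d # e). b i = 0)"
    if g: "\<bar>g\<bar> \<le> 2" and b: "\<forall>i<length (d # e). \<bar>b i\<bar> \<le> 2"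
      and eq: "8 * g + (\<Sum>i<length (d # e). b i * (d # e) ! i) = 0" for g b
  proof -
    let ?s = "\<Sum>i<length e. b (Suc i) * e ! i"
    have b': "\<forall>i<length e. \<bar>b (Suc i)\<bar> \<le> 2" using b by auto
    have "b 0 * d = - (8 * g + ?s)"
      using eq unfolding sum_lessThan_nth_Cons by linarith
    moreover have "\<bar>?s\<bar> \<le> 2 * sum_list (map abs e)"
      using b' by (intro abs_sum_mult_nth_le) auto
    then have "\<bar>- (8 * g + ?s)\<bar> < d" using g big by linarith
    ultimately have b0: "b 0 = 0" by (rule zero_if_abs_mult_less)
    then have "8 * g + ?s = 0" using eq unfolding sum_lessThan_nth_Cons by simp
    from two_independentD[OF ind, OF g b' this] b0 show ?thesis by (simp only: all_less_length_Cons) blast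
  qed
  have "sorted_wrt coprime (d # e)"
    using e(2) cop by (auto intro!: cop dvd_mult prod_list_dvd)
  moreover have "\<forall>c\<in>set (d # e). coprime c P" using e(3) cop by auto
  moreover have "two_independent 8 (d # e)"
    unfolding two_independent_def using zero by blast
  ultimately show ?case using e(1) by (intro exI[of _ "d # e"]) auto
qed

text \<open>The shift \<open>t\<close> is chosen such that every prime divisor of \<open>W\<close> divides exactly one of \<open>h\<close> and \<open>t\<close>.\<close>

lemma exists_shift_coprime:
  fixes h W T :: int
  assumes "h \<noteq> 0" "W \<noteq> 0"
  shows "\<exists>t>T. coprime (h + t) W \<and> coprime (h - t) W"
proof -
  \<comment> \<open>A prime beyond the size of \<open>h\<close> cannot divide \<open>h\<close>, so
    \<open>D\<close> is nonempty, its product is at least 2, and a high power of it exceeds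
    \<open>T\<close>.\<close>
  obtain r :: nat where r: "prime r" "r > nat \<bar>h\<bar>" using bigger_prime by blast
  define D where "D = {q. prime q \<and> q dvd W * int r \<and> \<not> q dvd h}"
  have "W * int r \<noteq> 0" using assms r by auto
  then have fin: "finite D"
    unfolding D_def by (intro finite_subset[OF _ finite_divisors_int[of "W * int r"]]) auto
  have rD: "int r \<in> D"
    using r assms zdvd_imp_le[of "int r" "\<bar>h\<bar>"] by (auto simp: D_def)
  define t where "t = (\<Prod>D) ^ nat (\<bar>T\<bar> + 1)"
  have qt: "q dvd t \<longleftrightarrow> \<not> q dvd h" if q: "prime q" "q dvd W" for q
  proof
    assume "q dvd t"
    then have "q dvd \<Prod>D" using q prime_dvd_power unfolding t_def by blast
    then obtain p where "p \<in> D" "q dvd p" using q fin by (auto simp: prime_dvd_prod_iff)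
    then show "\<not> q dvd h" using q primes_dvd_imp_eq[of q p] by (auto simp: D_def)
  next
    assume "\<not> q dvd h"
    then have "q \<in> D" using q by (auto simp: D_def)
    then have "q dvd \<Prod>D" using fin by (metis dvd_prod_eqI)
    then show "q dvd t" unfolding t_def by (rule dvd_power_le[of _ _ 1, simplified]) simp
  qed
  have "int r dvd \<Prod>D" using fin rD by (metis dvd_prod_eqI)
  moreover have "\<Prod>D > 0" by (intro prod_pos) (auto simp: D_def prime_gt_0_int)
  ultimately have "\<Prod>D \<ge> 2" using zdvd_imp_le prime_ge_2_nat[OF r(1)] by force
  then have "2 ^ nat (\<bar>T\<bar> + 1) \<le> t" unfolding t_def by (intro power_mono) auto
  moreover have "int (nat (\<bar>T\<bar> + 1)) < 2 ^ nat (\<bar>T\<bar> + 1)" by (rule of_nat_less_two_power)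
  ultimately have "t > T" by linarith
  moreover have "coprime c W" if c: "c = h + t \<or> c = h - t" for c
  proof (rule ccontr)
    assume "\<not> coprime c W"
    then have "\<not> is_unit (gcd c W)" by (simp add: coprime_iff_gcd_eq_1)
    moreover have "gcd c W \<noteq> 0" using assms(2) by simp
    ultimately obtain q where "q dvd gcd c W" and q: "prime q"
      using prime_divisor_exists by blast
    then have "q dvd c" "q dvd W" by auto
    with qt[OF q] c show False
      by (auto simp: dvd_add_left_iff dvd_add_right_iff dvd_diff_left_iff dvd_diff_right_iff)
  qed
  ultimately show ?thesis by blast
qed

text \<open>An independent list \<open>e\<close> is completed by \<open>h + t\<close> and
  \<open>h - t\<close>, where \<open>2 * h = 8 - sum_list e\<close>. The size of \<open>t\<close>
  forces equal coefficients on these two; what remains is a relation between 8 and \<open>e\<close>,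
  trivial by independence.\<close>

lemma exists_constants:
  fixes P :: int
  assumes "P > 0" "even P" "even m"
  shows "\<exists>cs. length cs = m + 2 \<and> sorted_wrt coprime cs \<and> (\<forall>c\<in>set cs. coprime c P) \<and>
    sum_list cs = 8 \<and> only_full_subsum 8 cs"
proof -
  obtain e where e: "length e = m" "sorted_wrt coprime e" "\<forall>c\<in>set e. coprime c P"
    and ind: "two_independent 8 e"
    using exists_independent_coprime_list[OF assms(1,2), of m] by blast
  have sum_e: "sum_list e = (\<Sum>i<length e. e ! i)"
    by (simp add: sum_list_sum_nth atLeast0LessThan)
  \<comment> \<open>Oddness of the entries and evenness of \<open>m\<close> make
    \<open>sum_list e\<close> even, so that \<open>h\<close> is an integer.\<close>
  have "odd c" if "c \<in> set e" for c
    using e(3) that assms(2) coprime_common_divisor[of c P 2] by auto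
  then have "even (sum_list e) \<longleftrightarrow> even (length e)"
    by (induction e) auto
  then obtain h where h: "8 - sum_list e = 2 * h"
    using e(1) assms(3) by (metis dvd_def dvd_diff even_numeral)
  have "h \<noteq> 0"
  proof
    assume "h = 0"
    then have "8 * 1 + (\<Sum>i<length e. (-1) * e ! i) = 0" using h sum_e by (simp add: sum_negf)
    from two_independentD[OF ind, OF _ _ this] show False by simp
  qed
  have "0 \<notin> set e" using e(3) assms(1,2) by (auto simp: zdvd1_eq)
  then have W: "2 * h * P * prod_list e \<noteq> 0"
    using \<open>h \<noteq> 0\<close> assms(1) by (simp add: prod_list_zero_iff)
  obtain t where t: "t > 8 + 2 * \<bar>h\<bar> + sum_list (map abs e)"
    and cop1: "coprime (h + t) (2 * h * P * prod_list e)"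
    and cop2: "coprime (h - t) (2 * h * P * prod_list e)"
    using exists_shift_coprime[OF \<open>h \<noteq> 0\<close> W] by blast
  have cop: "coprime (h + t) z" "coprime (h - t) z" if "z dvd 2 * h * P * prod_list e" for z
    using cop1 cop2 that by (blast intro: coprime_divisors[OF dvd_refl])+
  let ?cs = "(h + t) # (h - t) # e"
  \<comment> \<open>A common divisor divides \<open>2 * h\<close>; this is why \<open>2 * h\<close>
    is a factor of the modulus used in the choice of \<open>t\<close>.\<close>
  have "coprime (h + t) (h - t)"
  proof (rule coprimeI)
    fix c assume c: "c dvd h + t" "c dvd h - t"
    then have "c dvd (h + t) + (h - t)" by (rule dvd_add)
    then have "c dvd 2 * h * P * prod_list e" by simp
    from coprime_common_divisor[OF cop(1)[OF this] c(1) dvd_refl] show "is_unit c" .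
  qed
  then have "sorted_wrt coprime ?cs"
    using e(2) cop[OF dvd_mult[OF prod_list_dvd]] by simp
  moreover have "\<forall>c\<in>set ?cs. coprime c P" using e(3) cop[of P] by simp
  moreover have "sum_list ?cs = 8" using h by simp
  moreover have "\<forall>i<length ?cs. b i = g"
    if g: "g \<in> {-1, 0, 1}" and b: "\<forall>i<length ?cs. b i \<in> {-1, 0, 1}"
      and eq: "(\<Sum>i<length ?cs. b i * ?cs ! i) = 8 * g" for g b
  proof -
    let ?s = "\<Sum>i<length e. b (Suc (Suc i)) * e ! i"
    have b01: "b 0 \<in> {-1, 0, 1}" "b 1 \<in> {-1, 0, 1}"
      and b2: "\<forall>i<length e. b (Suc (Suc i)) \<in> {-1, 0, 1}"
      using b by (auto simp: all_less_length_Cons)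
    have eq': "b 0 * (h + t) + (b 1 * (h - t) + ?s) = 8 * g"
      using eq unfolding sum_lessThan_nth_Cons by simp
    have "\<bar>?s\<bar> \<le> 1 * sum_list (map abs e)"
      using b2 by (intro abs_sum_mult_nth_le) force
    moreover have "(b 0 - b 1) * t = 8 * g - (b 0 + b 1) * h - ?s"
      using eq' by (simp add: algebra_simps)
    moreover have "\<bar>(b 0 + b 1) * h\<bar> \<le> 2 * \<bar>h\<bar>"
      unfolding abs_mult using b01 by (intro mult_right_mono) auto
    moreover have "\<bar>8 * g\<bar> \<le> 8" using g by auto
    ultimately have "b 0 - b 1 = 0" using t
      by (intro zero_if_abs_mult_less[of _ t "8 * g - (b 0 + b 1) * h - ?s"]) linarith+
    then have b1: "b 1 = b 0" by simp
    \<comment> \<open>This eliminates \<open>h\<close> and leaves differences of coefficients, of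
      size at most 2, on 8 and on \<open>e\<close>.\<close>
    moreover have "b 0 * (8 - sum_list e) = b 0 * (2 * h)" by (simp only: h)
    ultimately have "8 * (b 0 - g) + (?s - b 0 * sum_list e) = 0"
      using eq' by (simp add: algebra_simps)
    moreover have "?s - b 0 * sum_list e = (\<Sum>i<length e. (b (Suc (Suc i)) - b 0) * e ! i)"
      by (simp add: sum_e sum_distrib_left sum_subtractf algebra_simps)
    ultimately have "8 * (b 0 - g) + (\<Sum>i<length e. (b (Suc (Suc i)) - b 0) * e ! i) = 0"
      by simp
    moreover have "\<bar>b 0 - g\<bar> \<le> 2" using b01 g by auto
    moreover have "\<forall>i<length e. \<bar>b (Suc (Suc i)) - b 0\<bar> \<le> 2" using b01 b2 by force
    ultimately have "b 0 - g = 0 \<and> (\<forall>i<length e. b (Suc (Suc i)) - b 0 = 0)"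
      by (intro two_independentD[OF ind])
    then show ?thesis using b1 unfolding all_less_length_Cons by simp
  qed
  then have "only_full_subsum 8 ?cs" unfolding only_full_subsum_def by blast
  ultimately show ?thesis using e(1) by (intro exI[of _ ?cs]) simp
qed

section \<open>Membership of the quintic tuple in \<open>U\<close>\<close>

text \<open>As a polynomial in \<open>x\<close> the left-hand side has coefficients small against
  \<open>x\<close>. Divisibility by \<open>x\<close> removes them from the constant term upwards,
  and only a multiple of the basic identity survives.\<close>

lemma quintic_relation_trivial:
  fixes x s b\<^sub>0 b\<^sub>1 b\<^sub>2 :: int
  assumes b: "b\<^sub>0 \<in> {-1, 0, 1}" "b\<^sub>1 \<in> {-1, 0, 1}" "b\<^sub>2 \<in> {-1, 0, 1}"
    and x: "x > 12 + \<bar>s\<bar>"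
    and eq: "b\<^sub>0 * (x + 1) ^ 5 + (b\<^sub>1 * - ((x - 1) ^ 5) + (b\<^sub>2 * (-10 * (x\<^sup>2 + 1)\<^sup>2) + s)) = 0"
  shows "b\<^sub>1 = b\<^sub>0 \<and> b\<^sub>2 = b\<^sub>0 \<and> s = 8 * b\<^sub>0"
proof -
  \<comment> \<open>The relation reads \<open>Z * x\<^sup>2 + 5 * (b\<^sub>0 - b\<^sub>1) * x +
    (b\<^sub>0 + b\<^sub>1 - 10 * b\<^sub>2 + s) = 0\<close>. The last bracket has size at most
    \<open>12 + \<bar>s\<bar>\<close>, whence the bound on \<open>x\<close>.\<close>
  define Z where "Z = (b\<^sub>0 - b\<^sub>1) * (x ^ 3 + 10 * x) + (5 * (b\<^sub>0 + b\<^sub>1) - 10 * b\<^sub>2) * (x\<^sup>2 + 2)"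
  have "(Z * x + 5 * (b\<^sub>0 - b\<^sub>1)) * x = - (b\<^sub>0 + b\<^sub>1 - 10 * b\<^sub>2 + s)"
    using eq unfolding Z_def by algebra
  moreover have "\<bar>- (b\<^sub>0 + b\<^sub>1 - 10 * b\<^sub>2 + s)\<bar> < x" using b x by auto
  ultimately have Y: "Z * x + 5 * (b\<^sub>0 - b\<^sub>1) = 0" by (rule zero_if_abs_mult_less)
  then have "Z * x = 5 * (b\<^sub>1 - b\<^sub>0)" by simp
  moreover have "\<bar>5 * (b\<^sub>1 - b\<^sub>0)\<bar> < x" using b x by auto
  ultimately have Z: "Z = 0" by (rule zero_if_abs_mult_less)
  with Y have b1: "b\<^sub>1 = b\<^sub>0" by simp
  then have "10 * (b\<^sub>0 - b\<^sub>2) * (x\<^sup>2 + 2) = 0"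
    using Z by (simp add: Z_def algebra_simps)
  moreover have "x\<^sup>2 + 2 \<noteq> 0" by (smt (verit) zero_le_power2)
  ultimately have b2: "b\<^sub>2 = b\<^sub>0" by simp
  have "s = 8 * b\<^sub>0" using eq unfolding b1 b2 by algebra
  with b1 b2 show ?thesis by simp
qed

text \<open>Up to sign and the factor 10, the first three entries are powers of numbers congruent to
  1 or -1 modulo \<open>x\<close>, hence coprime to \<open>P\<close>, to 10 and to the constants.
  Common divisors of two of these bases divide 2, which parity excludes.\<close>

lemma quintic_tuple_in_U:
  fixes P x :: int
  assumes F: "\<And>m. m \<in> F \<Longrightarrow> \<not> m dvd 10" "\<And>m. m \<in> F \<Longrightarrow> int m dvd P"
    and P: "10 dvd P"
    and cs: "sorted_wrt coprime cs" "\<And>c. c \<in> set cs \<Longrightarrow> coprime c P" "sum_list cs = 8"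
    and ind: "only_full_subsum 8 cs"
    and x: "P * prod_list cs dvd x" "x > 12 + sum_list (map abs cs)"
  shows "(x + 1) ^ 5 # - ((x - 1) ^ 5) # (-10 * (x\<^sup>2 + 1)\<^sup>2) # cs \<in> U F (length cs + 3)"
proof -
  let ?a = "(x + 1) ^ 5 # - ((x - 1) ^ 5) # (-10 * (x\<^sup>2 + 1)\<^sup>2) # cs"
  have cop: "coprime (x + 1) z" "coprime (x - 1) z" "coprime (x\<^sup>2 + 1) z" if "z dvd x" for z
    using that coprime_if_dvd_diff_unit[of 1 z "x + 1"] coprime_if_dvd_diff_unit[of "-1" z "x - 1"]
      coprime_if_dvd_diff_unit[of 1 z "x\<^sup>2 + 1"] by (simp_all add: power2_eq_square)
  have Px: "P dvd x" using x(1) by (rule dvd_mult_left)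
  then have x10: "10 dvd x" using P by (rule dvd_trans[rotated])
  then have "even x" by (rule dvd_trans[rotated]) simp
  have coprime_if_two: "coprime u v" if "odd u" "\<And>c. c dvd u \<Longrightarrow> c dvd v \<Longrightarrow> c dvd 2" for u v :: int
    using that coprime_common_divisor[of u 2] by (intro coprimeI) auto
  have csx: "c dvd x" if "c \<in> set cs" for c
    using dvd_mult_right[OF x(1)] prod_list_dvd[OF that] by (rule dvd_trans[rotated])
  have c10: "coprime c 10" if "c \<in> set cs" for c
    using cs(2)[OF that] P by (rule coprime_divisors[OF dvd_refl, rotated])
  have "coprime (x + 1) (x - 1)"
  proof (rule coprime_if_two)
    fix c assume "c dvd x + 1" "c dvd x - 1"
    then have "c dvd (x + 1) - (x - 1)" by (rule dvd_diff)
    then show "c dvd 2" by simp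
  qed (use \<open>even x\<close> in simp)
  moreover have "coprime ((x + 1) * (x - 1)) (x\<^sup>2 + 1)"
  proof (rule coprime_if_two)
    fix c assume "c dvd (x + 1) * (x - 1)" "c dvd x\<^sup>2 + 1"
    then have "c dvd (x\<^sup>2 + 1) - (x + 1) * (x - 1)" by (rule dvd_diff[rotated])
    then show "c dvd 2" by (simp add: power2_eq_square algebra_simps)
  qed (use \<open>even x\<close> in simp)
  ultimately have sorted: "sorted_wrt coprime ?a"
    using cs(1) csx c10 cop cop[OF x10] by (simp add: coprime_commute)
  have sum: "(\<Sum>i<length ?a. ?a ! i) = 0"
  proof -
    have "(\<Sum>i<length ?a. ?a ! i) = sum_list ?a"
      by (simp only: sum_list_sum_nth atLeast0LessThan)
    also have "\<dots> = (x + 1) ^ 5 - (x - 1) ^ 5 - 10 * (x\<^sup>2 + 1)\<^sup>2 + 8"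
      using cs(3) by simp
    also have "\<dots> = 0" by algebra
    finally show ?thesis .
  qed
  \<comment> \<open>Once all coefficients of a vanishing signed sum agree, 0 and 1 cannot both occur
    among them.\<close>
  have full: "\<forall>i<length ?a. b i = b 0"
    if b: "\<forall>i<length ?a. b i \<in> {-1, 0, 1}" and eq: "(\<Sum>i<length ?a. b i * ?a ! i) = 0" for b
  proof -
    let ?s = "\<Sum>i<length cs. b (Suc (Suc (Suc i))) * cs ! i"
    have b012: "b 0 \<in> {-1, 0, 1}" "b 1 \<in> {-1, 0, 1}" "b 2 \<in> {-1, 0, 1}"
      and b3: "\<forall>i<length cs. b (Suc (Suc (Suc i))) \<in> {-1, 0, 1}"
      using b by (auto simp: all_less_length_Cons numeral_2_eq_2)
    have "\<bar>?s\<bar> \<le> 1 * sum_list (map abs cs)"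
      using b3 by (intro abs_sum_mult_nth_le) force
    then have "x > 12 + \<bar>?s\<bar>" using x(2) by linarith
    moreover have "b 0 * (x + 1) ^ 5 + (b 1 * - ((x - 1) ^ 5) + (b 2 * (-10 * (x\<^sup>2 + 1)\<^sup>2) + ?s)) = 0"
      using eq unfolding sum_lessThan_nth_Cons by (simp add: numeral_2_eq_2)
    ultimately have *: "b 1 = b 0 \<and> b 2 = b 0 \<and> ?s = 8 * b 0"
      using b012 by (intro quintic_relation_trivial)
    then have "\<forall>i<length cs. b (Suc (Suc (Suc i))) = b 0"
      using b012 b3 by (intro only_full_subsumD[OF ind]) auto
    with * show ?thesis unfolding all_less_length_Cons by (simp add: numeral_2_eq_2)
  qed
  have not_dvd: "\<not> int m dvd c" if m: "m \<in> F" and c: "c \<in> set ?a" for m c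
  proof
    assume dvd: "int m dvd c"
    have mP: "int m dvd P" and m10: "\<not> int m dvd 10"
      using F[OF m] by (simp_all add: int_dvd_int_iff[of m 10, simplified])
    have mx: "int m dvd x" using mP Px by (rule dvd_trans)
    \<comment> \<open>An \<open>m\<close> not dividing 10 is not 1, so it divides no entry coprime
      to it. In the remaining entry \<open>m\<close> is coprime to the square and would have to
      divide 10.\<close>
    have "coprime c (int m)" if "c \<noteq> -10 * (x\<^sup>2 + 1)\<^sup>2"
      using c that cop[OF mx] cs(2) mP by (auto intro: coprime_divisors[OF dvd_refl])
    with dvd m10 have "c = -10 * (x\<^sup>2 + 1)\<^sup>2"
      by (metis coprime_absorb_right one_dvd dvd_trans)
    moreover have "coprime (int m) ((x\<^sup>2 + 1)\<^sup>2)"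
      using cop(3)[OF mx] by (simp add: coprime_commute)
    ultimately show False using dvd m10 by (simp add: coprime_dvd_mult_left_iff)
  qed
  have "(\<forall>i<length ?a. \<forall>j<length ?a. i < j \<longrightarrow> gcd (?a ! i) (?a ! j) = 1) \<and>
      \<not> (\<exists>b :: nat \<Rightarrow> int. (\<forall>k<length ?a. b k \<in> {-1, 0, 1}) \<and>
        (\<exists>i<length ?a. \<exists>j<length ?a. b i = 0 \<and> b j = 1) \<and> (\<Sum>k<length ?a. b k * ?a ! k) = 0) \<and>
      (\<forall>i<length ?a. \<forall>m\<in>F. \<not> int m dvd ?a ! i)"
  proof (intro conjI notI allI impI ballI)
    fix i j assume "j < length ?a" "i < j"
    then show "gcd (?a ! i) (?a ! j) = 1"
      using sorted unfolding sorted_wrt_iff_nth_less coprime_iff_gcd_eq_1 by blast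
  next
    assume "\<exists>b :: nat \<Rightarrow> int. (\<forall>k<length ?a. b k \<in> {-1, 0, 1}) \<and>
      (\<exists>i<length ?a. \<exists>j<length ?a. b i = 0 \<and> b j = 1) \<and> (\<Sum>k<length ?a. b k * ?a ! k) = 0"
    then obtain b :: "nat \<Rightarrow> int" and i j where b: "\<forall>k<length ?a. b k \<in> {-1, 0, 1}"
      "(\<Sum>k<length ?a. b k * ?a ! k) = 0" and ij: "i < length ?a" "j < length ?a" "b i = 0" "b j = 1"
      by (elim exE conjE)
    from full[OF b] ij(1,2) have "b i = b 0" "b j = b 0" by blast+
    with ij(3,4) show False by simp
  next
    fix i m assume "i < length ?a" "m \<in> F" "int m dvd ?a ! i"
    with not_dvd[OF _ nth_mem] show False by blast
  qed
  moreover have "length ?a = length cs + 3" by simp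
  ultimately show ?thesis
    using sum unfolding U_def mem_Collect_eq by (simp only:) blast
qed

section \<open>Radical and quality of the quintic tuple\<close>

text \<open>The radical is squarefree, so it already divides the base of the power, whatever the
  exponent.\<close>

lemma rad_power_mult_le:
  fixes y z w :: int
  assumes "y > 0" "z > 0" "w \<noteq> 0" "N \<noteq> 0" "N dvd (y * z * w) ^ k"
  shows "rad N \<le> y * \<bar>w\<bar> * z"
proof -
  have "rad N dvd (y * z * w) ^ k"
    using rad_greatest(3)[OF assms(4)] assms(5) by (rule dvd_trans)
  then have "rad N dvd y * z * w"
    using rad_greatest(2)[OF assms(4)] squarefree_dvd_power_imp_dvd by blast
  then have "rad N \<le> \<bar>y * z * w\<bar>"
    using assms by (intro zdvd_imp_le) auto
  also have "\<dots> = y * \<bar>w\<bar> * z" using assms by (simp add: abs_mult)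
  finally show ?thesis .
qed

text \<open>The entry \<open>(x + 1) ^ 5 = y ^ (5 * k)\<close> bounds the maximum from below but
  adds only the fixed factor \<open>y\<close> to the bound on the radical.\<close>

lemma quality_quintic_tuple_ge:
  fixes y :: int
  assumes y: "y > 3" and k: "k > 0" and cs: "0 \<notin> set cs"
    and x: "x = y ^ k - 1"
  shows "real k * 5 * ln y / (real k * 3 * ln y + ln (10 * y * \<bar>prod_list cs\<bar>))
    \<le> quality ((x + 1) ^ 5 # - ((x - 1) ^ 5) # (-10 * (x\<^sup>2 + 1)\<^sup>2) # cs)"
    (is "?l \<le> quality ?a")
proof -
  let ?C = "10 * y * \<bar>prod_list cs\<bar>"
  have "y ^ 1 \<le> y ^ k" using y k by (intro power_increasing) auto
  then have x2: "x > 2" using x y by simp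
  have C0: "prod_list cs \<noteq> 0" using cs by (simp add: prod_list_zero_iff)
  then have C: "?C \<ge> 1" using y by (smt (verit) mult_pos_pos zero_less_abs_iff)
  have "x\<^sup>2 + 1 > 0" by (smt (verit) zero_le_power2)
  then have pos: "(x - 1) * (x\<^sup>2 + 1) > 0" using x2 by (intro mult_pos_pos) auto
  from \<open>x\<^sup>2 + 1 > 0\<close> have "x\<^sup>2 + 1 \<noteq> 0" by linarith
  then have N0: "prod_list ?a \<noteq> 0" using x2 C0 by simp
  have "prod_list ?a = y ^ (5 * k) * ((x - 1) ^ 5 * ((x\<^sup>2 + 1) ^ 2 * (10 * prod_list cs)))"
    using x by (simp add: power_mult[symmetric] mult.commute)
  \<comment> \<open>All exponents are raised to \<open>5 * k\<close>, so that the product divides a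
    single power.\<close>
  also have "\<dots> dvd y ^ (5 * k) * ((x - 1) ^ (5 * k) * ((x\<^sup>2 + 1) ^ (5 * k) * (10 * prod_list cs) ^ (5 * k)))"
    using k by (intro mult_dvd_mono le_imp_power_dvd dvd_refl dvd_power) auto
  also have "\<dots> = (y * ((x - 1) * (x\<^sup>2 + 1)) * (10 * prod_list cs)) ^ (5 * k)"
    by (simp only: power_mult_distrib mult.assoc)
  finally have "rad (prod_list ?a) \<le> y * \<bar>10 * prod_list cs\<bar> * ((x - 1) * (x\<^sup>2 + 1))"
    using y C0 by (intro rad_power_mult_le[OF _ pos _ N0]) auto
  also have "\<dots> = ?C * ((x - 1) * (x\<^sup>2 + 1))" by (simp add: abs_mult)
  also have "\<dots> \<le> ?C * (x + 1) ^ 3"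
  proof -
    have "(x + 1) ^ 3 - (x - 1) * (x\<^sup>2 + 1) = 4 * x\<^sup>2 + 2 * x + 2" by algebra
    then have "(x - 1) * (x\<^sup>2 + 1) \<le> (x + 1) ^ 3" using x2 by (smt (verit) zero_le_power2)
    then show ?thesis using C by (intro mult_left_mono) linarith+
  qed
  also have "(x + 1) ^ 3 = y ^ (3 * k)"
    using x by (simp add: power_mult[symmetric] mult.commute)
  finally have "rad (prod_list ?a) \<le> ?C * y ^ (3 * k)" .
  then have "real_of_int (rad (prod_list ?a)) \<le> ?C * real_of_int y ^ (3 * k)"
    by (metis of_int_le_iff of_int_mult of_int_power)
  \<comment> \<open>The entry with factor 10 makes the product even; the logarithm in the
    denominator is then positive.\<close>
  moreover have "2 \<le> rad (prod_list ?a)"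
    using N0 by (intro rad_greatest(4)) (auto intro: squarefree_prime)
  ultimately have "ln (rad (prod_list ?a)) \<le> ln (?C * real_of_int y ^ (3 * k))"
    by (subst ln_le_cancel_iff) auto
  also have "\<dots> = real k * 3 * ln y + ln ?C"
    using C y by (subst ln_mult) (auto simp: ln_realpow)
  finally have rad_le: "ln (rad (prod_list ?a)) \<le> real k * 3 * ln y + ln ?C" .
  have "y ^ (5 * k) = \<bar>(x + 1) ^ 5\<bar>"
    using x y by (simp add: power_mult[symmetric] mult.commute)
  also have "\<dots> \<le> Max ((\<lambda>x. \<bar>x\<bar>) ` set ?a)" by (intro Max_ge) auto
  finally have "real_of_int y ^ (5 * k) \<le> Max ((\<lambda>x. \<bar>x\<bar>) ` set ?a)"
    by (metis of_int_le_iff of_int_power)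
  then have "ln (real_of_int y ^ (5 * k)) \<le> ln (Max ((\<lambda>x. \<bar>x\<bar>) ` set ?a))"
    using y by (intro ln_mono) auto
  then have "real k * 5 * ln y \<le> ln (Max ((\<lambda>x. \<bar>x\<bar>) ` set ?a))"
    using y by (simp add: ln_realpow)
  moreover have "0 < ln (rad (prod_list ?a))" using \<open>2 \<le> rad (prod_list ?a)\<close> by simp
  moreover have "0 \<le> real k * 5 * ln y" using y by simp
  ultimately show ?thesis
    unfolding quality_def using rad_le by (intro frac_le) linarith+
qed

section \<open>Limit superior and conclusion\<close>

text \<open>A finite \<open>S\<close> meets an injective sequence in finitely many terms, so the
  supremum over \<open>A - S\<close> eventually bounds \<open>f k\<close> and hence its
  limit.\<close>

lemma Q_geI_inj_seq:
  assumes "inj a" "\<And>k. a k \<in> A" "\<And>k. f k \<le> quality (a k)" "f \<longlonglongrightarrow> l"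
  shows "Q A \<ge> ereal l"
  unfolding Q_def
proof (rule INF_greatest)
  fix S assume "S \<in> {S. finite S \<and> S \<subseteq> A}"
  then have "finite (a -` S)" using assms(1) by (simp add: finite_vimageI)
  then have "\<forall>\<^sub>F k in sequentially. k \<notin> a -` S"
    unfolding cofinite_eq_sequentially[symmetric] eventually_cofinite by (simp add: vimage_def)
  then have "\<forall>\<^sub>F k in sequentially. ereal (f k) \<le> (SUP a\<in>A - S. ereal (quality a))"
  proof eventually_elim
    case (elim k)
    then show ?case using assms(2,3) by (intro SUP_upper2[of "a k"]) auto
  qed
  then show "ereal l \<le> (SUP a\<in>A - S. ereal (quality a))"
    using assms(4) by (intro tendsto_upperbound[of "\<lambda>k. ereal (f k)"]) auto
qed

lemma Q_U_ge_five_thirds: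
  assumes "finite F" "0 \<notin> F" "\<And>m. m \<in> F \<Longrightarrow> \<not> m dvd 10" "odd n" "n \<ge> 5"
  shows "Q (U F n) \<ge> ereal (5 / 3)"
proof -
  define P where "P = int (10 * \<Prod>F)"
  have P: "P > 0" "10 dvd P" "even P"
    using assms(1,2) by (auto simp: P_def intro!: prod_pos gr0I)
  have FP: "int m dvd P" if "m \<in> F" for m
    unfolding P_def int_dvd_int_iff using assms(1) that by (intro dvd_mult) (metis dvd_prod_eqI)
  \<comment> \<open>The \<open>n - 3\<close> constants consist of \<open>n - 5\<close> independent
    ones and the final pair.\<close>
  have "even (n - 5)" using assms(4,5) by simp
  then obtain cs where cs: "length cs = n - 5 + 2" "sorted_wrt coprime cs"
      "\<And>c. c \<in> set cs \<Longrightarrow> coprime c P" "sum_list cs = 8"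
    and ind: "only_full_subsum 8 cs"
    using exists_constants[OF P(1,3), of "n - 5"] by auto
  have n: "length cs + 3 = n" using cs(1) assms(5) by simp
  have cs0: "0 \<notin> set cs" using cs(3)[of 0] P by auto
  have nonneg: "sum_list (map abs cs) \<ge> 0" by (intro sum_list_nonneg) auto
  \<comment> \<open>With \<open>y = M + 1\<close>, \<open>M\<close> divides every
    \<open>y ^ Suc k - 1\<close>. The first two factors give the divisibility required of
    \<open>x k\<close>, the last one its size.\<close>
  define M where "M = P * \<bar>prod_list cs\<bar> * (13 + sum_list (map abs cs))"
  have "P * \<bar>prod_list cs\<bar> > 0"
    using P cs0 by (simp add: prod_list_zero_iff)
  then have "1 * (13 + sum_list (map abs cs)) \<le> M"
    unfolding M_def using nonneg by (intro mult_right_mono) auto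
  then have M: "M > 12 + sum_list (map abs cs)" by simp
  define y where "y = M + 1"
  have y: "y > 3" using M nonneg by (simp add: y_def)
  \<comment> \<open>The exponent starts at 1, since \<open>y ^ 0 - 1 = 0\<close> would be too
    small.\<close>
  define x where "x k = y ^ Suc k - 1" for k
  define a where "a k = (x k + 1) ^ 5 # - ((x k - 1) ^ 5) # (-10 * ((x k)\<^sup>2 + 1)\<^sup>2) # cs" for k
  show ?thesis
  proof (rule Q_geI_inj_seq)
    show "inj a"
    proof (rule injI)
      fix k l assume "a k = a l"
      then have "(y ^ Suc k) ^ 5 = (y ^ Suc l) ^ 5" by (simp add: a_def x_def del: power_Suc)
      then have "y ^ (Suc k * 5) = y ^ (Suc l * 5)" by (simp only: power_mult)
      then have "Suc k * 5 = Suc l * 5" using y by (subst (asm) power_inject_exp) auto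
      then show "k = l" by simp
    qed
    show "a k \<in> U F n" for k
    proof -
      have "M dvd x k"
        unfolding x_def power_diff_1_eq by (simp add: y_def)
      have "y ^ 1 \<le> y ^ Suc k" using y by (intro power_increasing) auto
      then have "x k \<ge> M" by (simp add: x_def y_def)
      show ?thesis
        unfolding a_def n[symmetric]
      proof (rule quintic_tuple_in_U[OF assms(3) FP P(2) cs(2-4) ind])
        have "P * prod_list cs dvd M" by (simp add: M_def)
        then show "P * prod_list cs dvd x k" using \<open>M dvd x k\<close> by (rule dvd_trans)
      qed (use \<open>x k \<ge> M\<close> M in auto)
    qed
    show "real (Suc k) * 5 * ln y / (real (Suc k) * 3 * ln y + ln (10 * y * \<bar>prod_list cs\<bar>)) \<le> quality (a k)" for k
      unfolding a_def using y cs0 by (intro quality_quintic_tuple_ge) (auto simp: x_def)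
    have "(\<lambda>k. real k * 5 * c / (real k * 3 * c + d)) \<longlonglongrightarrow> 5 / 3" if "c > 0" for c d :: real
      using that by real_asymp
    from LIMSEQ_Suc[OF this[of "ln y"]] y
    show "(\<lambda>k. real (Suc k) * 5 * ln y / (real (Suc k) * 3 * ln y + ln (10 * y * \<bar>prod_list cs\<bar>))) \<longlonglongrightarrow> 5 / 3"
      by simp
  qed
qed

theorem theorem1p12:
  fixes F :: "nat set"
  assumes "finite F"
    and "F = {} \<or> Min F \<ge> 3"
    and "2 \<notin> F" and "5 \<notin> F" and "10 \<notin> F"
  shows "(\<forall>n::nat. odd n \<and> n \<ge> 5 \<longrightarrow> Q (U F n) \<ge> ereal (5 / 3)) \<and>
         (\<forall>n::nat. odd n \<and> n \<ge> 5 \<longrightarrow> Q (U {} n) \<ge> ereal (5 / 3))"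
proof -
  have ge3: "m \<ge> 3" if "m \<in> F" for m
    using assms(1,2) that by (metis Min_le empty_iff le_trans)
  \<comment> \<open>The divisors of 10 are 1, 2, 5 and 10, none of which lies in
    \<open>F\<close>.\<close>
  have "\<not> m dvd 10" if "m \<in> F" for m
  proof
    assume "m dvd 10"
    then have "m \<le> 10" by (rule dvd_imp_le) simp
    with ge3[OF that] have "m \<in> {3, 4, 5, 6, 7, 8, 9, 10}" by auto
    with \<open>m dvd 10\<close> that assms show False by auto
  qed
  moreover have "0 \<notin> F" using ge3 by force
  ultimately show ?thesis using assms(1) by (auto intro!: Q_U_ge_five_thirds)
qed

end
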